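(* Let $s_0^{[1]},\dots,s_7^{[1]},\pi^{[1]}$ and $\varphi_{12}$ be the automorphisms of the field $K=\mathbb C(e_1,\dots,e_8,h_1,h_2,x,y)$ given in the context, and define $$s_i^{[2]}=\varphi_{12}\,s_i^{[1]}\,\varphi_{12}^{-1}\ (i=0,\dots,7),\qquad \pi^{[2]}=\varphi_{12}\,\pi^{[1]}\,\varphi_{12}^{-1}.$$ Then these automorphisms act on the parameters by $$s_0^{[2]}=\mu_{34},\ s_1^{[2]}=r_{12},\ s_2^{[2]}=\nu_{23},\ s_3^{[2]}=r_{34},\ s_4^{[2]}=r_{45},\ s_5^{[2]}=r_{56},\ s_6^{[2]}=r_{67},\ s_7^{[2]}=r_{78},$$ $$\pi^{[2]}:\ h_1\mapsto h_1,\quad h_2\mapsto\frac{h_1^2h_2}{e_3e_4e_5e_6},\quad e_1\leftrightarrow e_8,\quad e_2\leftrightarrow e_7,\quad e_i\mapsto\frac{h_1}{e_{9-i}}\ (i=3,4,5,6),$$ and on $x,y$ by $$s_0^{[2]}:\ x\mapsto\frac{h_2(xy-a_1x+a_2-h_2)}{(h_2-a_2)x+a_2y-a_1h_2},$$ $$s_2^{[2]}:\ y\mapsto\frac{e_2e_3xy-e_3(e_2e_3-h_1)x-e_3h_1y-h_2(e_2e_3-h_1)}{e_2e_3(x-e_3)},$$ $$\pi^{[2]}:\ x\mapsto\frac{h_1}{x},\qquad y\mapsto\frac{h_1\{h_2x^2y-h_2b_1x^2-(b_4-h_2b_2+h_2^2)x+b_4y-h_2b_3\}}{b_4(xy-x^2-h_2)},$$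 all variables $x,y$ not mentioned for a given generator being fixed, where $\prod_{i=3}^4(1+te_i)=\sum_{i=0}^2a_it^i$ and $\prod_{i=3}^6(1+te_i)=\sum_{i=0}^4b_it^i$.
   Context: All maps are $\mathbb C$-automorphisms of the rational function field $K=\mathbb C(e_1,\dots,e_8,h_1,h_2,x,y)$; composition is $(\alpha\beta)(F)=\alpha(\beta(F))$; generators of $K$ not mentioned are fixed. On the parameters $e_1,\dots,e_8,h_1,h_2$ define $$r_{ij}:e_i\leftrightarrow e_j;\quad c:h_1\leftrightarrow h_2;\quad \mu_{ij}:e_i\mapsto\tfrac{h_2}{e_j},\ e_j\mapsto\tfrac{h_2}{e_i},\ h_1\mapsto\tfrac{h_1h_2}{e_ie_j};\quad \nu_{ij}:e_i\mapsto\tfrac{h_1}{e_j},\ e_j\mapsto\tfrac{h_1}{e_i},\ h_2\mapsto\tfrac{h_1h_2}{e_ie_j}.$$ Representation 1. On parameters: $s_0^{[1]}=c$, $s_1^{[1]}=r_{12}$, $s_2^{[1]}=r_{23}$, $s_3^{[1]}=r_{34}$, $s_4^{[1]}=\mu_{45}$, $s_5^{[1]}=r_{56}$, $s_6^{[1]}=r_{67}$, $s_7^{[1]}=r_{78}$, and $\pi^{[1]}:h_i\mapsto h_i,\ e_i\mapsto e_{9-i}$. On $x,y$ (all others fixed): $$s_0^{[1]}:x\mapsto\tfrac1y,\ y\mapsto\tfrac1x;\qquad s_4^{[1]}:x\mapsto\frac{e_4(h_1-h_2)x+h_2(e_4e_5-h_1)xy-h_1(e_4e_5-h_2)}{e_4(e_4e_5-h_2)xy-e_4(e_4e_5-h_1)-e_4e_5(h_1-h_2)y};\qquad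 \pi^{[1]}:x\mapsto\tfrac{h_1}{x},\ y\mapsto\tfrac1{h_2y}.$$ The automorphism $\varphi_{12}$ is $$\varphi_{12}:\ x\mapsto\frac{h_2\{(e_3+e_4)x-e_3e_4+h_2-xy\}}{(e_3+e_4)h_2+(e_3e_4-h_2)x-e_3e_4y},\quad y\mapsto\frac1x,\quad e_3\mapsto\frac{h_1}{e_3},\ e_4\mapsto\frac{h_1}{e_4},\ h_1\mapsto\frac{h_1h_2}{e_3e_4},\ h_2\mapsto h_1.$$ *)

theory Defs
  imports
    Complex_Main
    "HOL-Library.Poly_Mapping"
    "HOL-Computational_Algebra.Polynomial"
    "HOL-Computational_Algebra.Fraction_Field"
begin

datatype gen = E1 | E2 | E3 | E4 | E5 | E6 | E7 | E8 | H1 | H2 | X | Y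

text \<open>
  An arbitrary linear order on the twelve indeterminates. Its only purpose is to make the
  instances of \<^theory>\<open>HOL-Library.Poly_Mapping\<close> apply which state that the polynomial ring
  is an integral domain.
\<close>

fun gen_rank :: "gen \<Rightarrow> nat" where
  "gen_rank E1 = 1" | "gen_rank E2 = 2" | "gen_rank E3 = 3" | "gen_rank E4 = 4"
| "gen_rank E5 = 5" | "gen_rank E6 = 6" | "gen_rank E7 = 7" | "gen_rank E8 = 8"
| "gen_rank H1 = 9" | "gen_rank H2 = 10" | "gen_rank X = 11" | "gen_rank Y = 12"

lemma gen_rank_inj: "gen_rank u = gen_rank v \<Longrightarrow> u = v"
  by (cases u; cases v) simp_all

instantiation gen :: linorder
begin

definition less_eq_gen :: "gen \<Rightarrow> gen \<Rightarrow> bool" where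
  "less_eq_gen u v \<longleftrightarrow> gen_rank u \<le> gen_rank v"

definition less_gen :: "gen \<Rightarrow> gen \<Rightarrow> bool" where
  "less_gen u v \<longleftrightarrow> gen_rank u < gen_rank v"

instance
  by standard (auto simp: less_eq_gen_def less_gen_def intro: gen_rank_inj)

end

text \<open>
  The field \<open>K\<close>: exponent vectors are maps from the indeterminates to \<^typ>\<open>nat\<close>, polynomials are
  finitely supported maps from exponent vectors to \<^typ>\<open>complex\<close> with convolution as product,
  and \<open>K\<close> is their field of fractions.
\<close>

type_synonym K = "((gen \<Rightarrow>\<^sub>0 nat) \<Rightarrow>\<^sub>0 complex) fract"

definition const :: "complex \<Rightarrow> K" where
  "const z = Fract (Poly_Mapping.single 0 z) 1"

definition var :: "gen \<Rightarrow> K" where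
  "var v = Fract (Poly_Mapping.single (Poly_Mapping.single v 1) 1) 1"

abbreviation "e1 \<equiv> var E1"
abbreviation "e2 \<equiv> var E2"
abbreviation "e3 \<equiv> var E3"
abbreviation "e4 \<equiv> var E4"
abbreviation "e5 \<equiv> var E5"
abbreviation "e6 \<equiv> var E6"
abbreviation "e7 \<equiv> var E7"
abbreviation "e8 \<equiv> var E8"
abbreviation "h1 \<equiv> var H1"
abbreviation "h2 \<equiv> var H2"
abbreviation "\<x> \<equiv> var X"
abbreviation "\<y> \<equiv> var Y"

definition C_automorphism :: "(K \<Rightarrow> K) \<Rightarrow> bool" where
  "C_automorphism \<phi> \<longleftrightarrow>
     bij \<phi> \<and>
     (\<forall>f g. \<phi> (f + g) = \<phi> f + \<phi> g) \<and>
     (\<forall>f g. \<phi> (f * g) = \<phi> f * \<phi> g) \<and>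
     (\<forall>z. \<phi> (const z) = const z)"

definition acts_by :: "(K \<Rightarrow> K) \<Rightarrow> (gen \<Rightarrow> K) \<Rightarrow> bool" where
  "acts_by \<phi> \<sigma> \<longleftrightarrow> C_automorphism \<phi> \<and> (\<forall>v. \<phi> (var v) = \<sigma> v)"

definition automorphism :: "(gen \<Rightarrow> K) \<Rightarrow> K \<Rightarrow> K" where
  "automorphism \<sigma> = (THE \<phi>. acts_by \<phi> \<sigma>)"

text \<open>
  An automorphism is specified by the images of the generators; \<^const>\<open>var\<close> itself specifies the
  identity, so an update of \<^const>\<open>var\<close> fixes all generators not mentioned.
\<close>

definition r :: "gen \<Rightarrow> gen \<Rightarrow> gen \<Rightarrow> K" where
  "r i j = var(i := var j, j := var i)"

definition c :: "gen \<Rightarrow> K" where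
  "c = var(H1 := h2, H2 := h1)"

definition mu :: "gen \<Rightarrow> gen \<Rightarrow> gen \<Rightarrow> K" where
  "mu i j = var(i := h2 / var j, j := h2 / var i, H1 := h1 * h2 / (var i * var j))"

definition nu :: "gen \<Rightarrow> gen \<Rightarrow> gen \<Rightarrow> K" where
  "nu i j = var(i := h1 / var j, j := h1 / var i, H2 := h1 * h2 / (var i * var j))"

definition s1_images :: "(gen \<Rightarrow> K) list" where
  "s1_images =
    [c(X := 1 / \<y>, Y := 1 / \<x>),
     r E1 E2,
     r E2 E3,
     r E3 E4,
     (mu E4 E5)
       (X := (e4 * (h1 - h2) * \<x> + h2 * (e4 * e5 - h1) * \<x> * \<y> - h1 * (e4 * e5 - h2)) /
             (e4 * (e4 * e5 - h2) * \<x> * \<y> - e4 * (e4 * e5 - h1) - e4 * e5 * (h1 - h2) * \<y>)),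
     r E5 E6,
     r E6 E7,
     r E7 E8]"

definition s1 :: "nat \<Rightarrow> K \<Rightarrow> K" where
  "s1 i = automorphism (s1_images ! i)"

definition pi1 :: "K \<Rightarrow> K" where
  "pi1 = automorphism
     (var(E1 := e8, E2 := e7, E3 := e6, E4 := e5, E5 := e4, E6 := e3, E7 := e2, E8 := e1,
          X := h1 / \<x>, Y := 1 / (h2 * \<y>)))"

definition phi12 :: "K \<Rightarrow> K" where
  "phi12 = automorphism
     (var(X := h2 * ((e3 + e4) * \<x> - e3 * e4 + h2 - \<x> * \<y>) /
               ((e3 + e4) * h2 + (e3 * e4 - h2) * \<x> - e3 * e4 * \<y>),
          Y := 1 / \<x>,
          E3 := h1 / e3, E4 := h1 / e4,
          H1 := h1 * h2 / (e3 * e4), H2 := h1))"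

definition s2 :: "nat \<Rightarrow> K \<Rightarrow> K" where
  "s2 i = phi12 \<circ> s1 i \<circ> inv phi12"

definition pi2 :: "K \<Rightarrow> K" where
  "pi2 = phi12 \<circ> pi1 \<circ> inv phi12"

end

(* Substituting sigma for the indeterminates is defined on a fraction as soon as some denominator
   of it does not vanish under sigma. If substituting tau into every sigma v gives back v, then
   sigma kills no nonzero polynomial p, since substituting tau into p(sigma) recovers p; hence
   sigma extends to the whole field. Two mutually inverse substitutions therefore give mutually
   inverse automorphisms, which avoids transcendence degree arguments. The inverse psi of phi12 is
   explicit, and conjugation by phi12 turns s into tau if and only if psi (tau v) = s (psi v) on
   every generator v, which is a list of rational identities. Nonvanishing of the denominators
   is checked at one complex point. *)
theory Submission
  imports Defs
begin

subsection \<open>Substitution into fractions\<close>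

lemma UNIV_gen: "UNIV = {E1, E2, E3, E4, E5, E6, E7, E8, H1, H2, X, Y}"
proof -
  have "v \<in> {E1, E2, E3, E4, E5, E6, E7, E8, H1, H2, X, Y}" for v
    by (cases v) simp_all
  then show ?thesis by auto
qed

instance gen :: finite
  by standard (simp add: UNIV_gen)

text \<open>Updating at a fresh key is the same as adding a monomial, so an additive property of
  polynomials only has to be understood on single monomials.\<close>

lemma poly_mapping_plus_induct [case_names zero add]:
  fixes p :: "'a \<Rightarrow>\<^sub>0 'b::monoid_add"
  assumes "P 0" and "\<And>p m a. P p \<Longrightarrow> P (p + Poly_Mapping.single m a)"
  shows "P p"
proof (induction p rule: update_induct)
  case const
  show ?case by fact
next
  case (update f a b)
  have "Poly_Mapping.update a b f = f + Poly_Mapping.single a b"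
    using update.hyps
    by (intro poly_mapping_eqI)
      (auto simp: lookup_update lookup_add lookup_single in_keys_iff when_def)
  then show ?case using assms(2) update.IH by simp
qed

section \<open>Evaluation of polynomials, and values of fractions with a nonvanishing
  denominator\<close>

type_synonym cpoly = "(gen \<Rightarrow>\<^sub>0 nat) \<Rightarrow>\<^sub>0 complex"

text \<open>Treats two evaluations at once: at complex points, with the identity as
  \<open>\<kappa>\<close>, and substitution of elements of \<open>K\<close>, with
  \<open>const\<close> as \<open>\<kappa>\<close>.\<close>

locale coefficient_hom =
  fixes \<kappa> :: "complex \<Rightarrow> 'b::field"
  assumes \<kappa>_add: "\<kappa> (a + b) = \<kappa> a + \<kappa> b"
    and \<kappa>_mult: "\<kappa> (a * b) = \<kappa> a * \<kappa> b"
    and \<kappa>_1: "\<kappa> 1 = 1"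
begin

lemma \<kappa>_0: "\<kappa> 0 = 0"
  using \<kappa>_add[of 0 0] by (metis add_0 add_cancel_right_right)

definition eval :: "(gen \<Rightarrow> 'b) \<Rightarrow> cpoly \<Rightarrow> 'b" where
  "eval \<sigma> p =
    (\<Sum>m\<in>Poly_Mapping.keys p. \<kappa> (Poly_Mapping.lookup p m) * (\<Prod>v\<in>UNIV. \<sigma> v ^ Poly_Mapping.lookup m v))"

lemma eval_0 [simp]: "eval \<sigma> 0 = 0"
  by (simp add: eval_def)

lemma eval_single:
  "eval \<sigma> (Poly_Mapping.single m a) = \<kappa> a * (\<Prod>v\<in>UNIV. \<sigma> v ^ Poly_Mapping.lookup m v)"
  by (simp add: eval_def \<kappa>_0)

lemma eval_add: "eval \<sigma> (p + q) = eval \<sigma> p + eval \<sigma> q"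
  unfolding eval_def
  by (rule setsum_keys_plus_distrib) (simp_all add: \<kappa>_0 \<kappa>_add distrib_right)

lemma eval_1 [simp]: "eval \<sigma> 1 = 1"
  using eval_single[of \<sigma> 0 1] by (simp add: \<kappa>_1)

lemma eval_single_mult_single:
  "eval \<sigma> (Poly_Mapping.single m a * Poly_Mapping.single n b) =
    eval \<sigma> (Poly_Mapping.single m a) * eval \<sigma> (Poly_Mapping.single n b)"
  by (simp add: mult_single eval_single \<kappa>_mult lookup_add power_add prod.distrib)

text \<open>Both sides are additive in each factor, which reduces the claim to products of two
  monomials.\<close>

lemma eval_mult: "eval \<sigma> (p * q) = eval \<sigma> p * eval \<sigma> q"
proof (induction p rule: poly_mapping_plus_induct)
  case (add p m a)
  have "eval \<sigma> (Poly_Mapping.single m a * q) = eval \<sigma> (Poly_Mapping.single m a) * eval \<sigma> q"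
    by (induction q rule: poly_mapping_plus_induct)
      (simp_all add: eval_add eval_single_mult_single distrib_left)
  with add show ?case by (simp add: eval_add distrib_right)
qed simp

lemma eval_uminus: "eval \<sigma> (- p) = - eval \<sigma> p"
  using eval_add[of \<sigma> "- p" p] by (simp add: eq_neg_iff_add_eq_0)

text \<open>A relation, because evaluation is only partially defined on fractions: a representative
  with vanishing denominator says nothing, while another one may still give a value.\<close>

definition has_value :: "(gen \<Rightarrow> 'b) \<Rightarrow> K \<Rightarrow> 'b \<Rightarrow> bool" where
  "has_value \<sigma> f z \<longleftrightarrow> (\<exists>p q. f = Fract p q \<and> eval \<sigma> q \<noteq> 0 \<and> z = eval \<sigma> p / eval \<sigma> q)"

lemma has_value_Fract: "eval \<sigma> q \<noteq> 0 \<Longrightarrow> has_value \<sigma> (Fract p q) (eval \<sigma> p / eval \<sigma> q)"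
  by (auto simp: has_value_def)

text \<open>Two representatives satisfy \<open>p * q' = p' * q\<close>, and evaluation preserves
  this equation.\<close>

lemma has_value_unique:
  assumes "has_value \<sigma> f z" and "has_value \<sigma> f w"
  shows "z = w"
proof -
  obtain p q where pq: "f = Fract p q" "eval \<sigma> q \<noteq> 0" "z = eval \<sigma> p / eval \<sigma> q"
    using assms(1) by (auto simp: has_value_def)
  obtain p' q' where pq': "f = Fract p' q'" "eval \<sigma> q' \<noteq> 0" "w = eval \<sigma> p' / eval \<sigma> q'"
    using assms(2) by (auto simp: has_value_def)
  have "q \<noteq> 0" "q' \<noteq> 0" using pq pq' by auto
  then have "p * q' = p' * q" using pq(1) pq'(1) by (simp add: eq_fract)
  then have "eval \<sigma> p * eval \<sigma> q' = eval \<sigma> p' * eval \<sigma> q" by (metis eval_mult)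
  then show ?thesis using pq pq' by (simp add: frac_eq_eq)
qed

lemma has_value_0: "has_value \<sigma> 0 0"
  using has_value_Fract[of \<sigma> 1 0] by (simp add: Zero_fract_def)

lemma has_value_1: "has_value \<sigma> 1 1"
  using has_value_Fract[of \<sigma> 1 1] by (simp add: One_fract_def)

lemma has_value_const: "has_value \<sigma> (const z) (\<kappa> z)"
  using has_value_Fract[of \<sigma> 1 "Poly_Mapping.single 0 z"] by (simp add: const_def eval_single)

lemma has_value_var: "has_value \<sigma> (var v) (\<sigma> v)"
proof -
  have "(\<Prod>u\<in>UNIV. \<sigma> u ^ Poly_Mapping.lookup (Poly_Mapping.single v 1) u) =
      (\<Prod>u\<in>UNIV. if u = v then \<sigma> u else 1)"
    by (rule prod.cong) (auto simp: lookup_single)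
  then have "eval \<sigma> (Poly_Mapping.single (Poly_Mapping.single v 1) 1) = \<sigma> v"
    by (simp add: eval_single \<kappa>_1)
  then show ?thesis
    using has_value_Fract[of \<sigma> 1 "Poly_Mapping.single (Poly_Mapping.single v 1) 1"]
    by (simp add: var_def)
qed

lemma has_value_add:
  assumes "has_value \<sigma> f z" and "has_value \<sigma> g w"
  shows "has_value \<sigma> (f + g) (z + w)"
proof -
  obtain p q where pq: "f = Fract p q" "eval \<sigma> q \<noteq> 0" "z = eval \<sigma> p / eval \<sigma> q"
    using assms(1) by (auto simp: has_value_def)
  obtain p' q' where pq': "g = Fract p' q'" "eval \<sigma> q' \<noteq> 0" "w = eval \<sigma> p' / eval \<sigma> q'"
    using assms(2) by (auto simp: has_value_def)
  have "q \<noteq> 0" "q' \<noteq> 0" using pq pq' by auto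
  with pq pq' has_value_Fract[of \<sigma> "q * q'" "p * q' + p' * q"] show ?thesis
    by (simp add: eval_mult eval_add add_frac_eq)
qed

lemma has_value_uminus:
  assumes "has_value \<sigma> f z"
  shows "has_value \<sigma> (- f) (- z)"
proof -
  obtain p q where pq: "f = Fract p q" "eval \<sigma> q \<noteq> 0" "z = eval \<sigma> p / eval \<sigma> q"
    using assms by (auto simp: has_value_def)
  then show ?thesis
    using has_value_Fract[of \<sigma> q "- p"] by (simp add: eval_uminus)
qed

lemma has_value_diff:
  "has_value \<sigma> f z \<Longrightarrow> has_value \<sigma> g w \<Longrightarrow> has_value \<sigma> (f - g) (z - w)"
  using has_value_add[of \<sigma> f z "- g" "- w"] has_value_uminus[of \<sigma> g w] by simp

lemma has_value_mult:
  assumes "has_value \<sigma> f z" and "has_value \<sigma> g w"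
  shows "has_value \<sigma> (f * g) (z * w)"
proof -
  obtain p q where pq: "f = Fract p q" "eval \<sigma> q \<noteq> 0" "z = eval \<sigma> p / eval \<sigma> q"
    using assms(1) by (auto simp: has_value_def)
  obtain p' q' where pq': "g = Fract p' q'" "eval \<sigma> q' \<noteq> 0" "w = eval \<sigma> p' / eval \<sigma> q'"
    using assms(2) by (auto simp: has_value_def)
  from pq pq' has_value_Fract[of \<sigma> "q * q'" "p * p'"] show ?thesis
    by (simp add: eval_mult)
qed

text \<open>A nonzero value means that the numerator does not vanish either, so numerator and
  denominator may be exchanged.\<close>

lemma has_value_inverse:
  assumes "has_value \<sigma> f z" and "z \<noteq> 0"
  shows "has_value \<sigma> (inverse f) (inverse z)"
proof -
  obtain p q where pq: "f = Fract p q" "eval \<sigma> q \<noteq> 0" "z = eval \<sigma> p / eval \<sigma> q"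
    using assms(1) by (auto simp: has_value_def)
  with assms(2) has_value_Fract[of \<sigma> p q] show ?thesis by simp
qed

lemma has_value_divide:
  "has_value \<sigma> f z \<Longrightarrow> has_value \<sigma> g w \<Longrightarrow> w \<noteq> 0 \<Longrightarrow> has_value \<sigma> (f / g) (z / w)"
  by (simp add: divide_inverse has_value_mult has_value_inverse)

lemma has_value_power: "has_value \<sigma> f z \<Longrightarrow> has_value \<sigma> (f ^ n) (z ^ n)"
  by (induction n) (simp_all add: has_value_1 has_value_mult)

lemma has_value_prod:
  "finite A \<Longrightarrow> (\<And>u. u \<in> A \<Longrightarrow> has_value \<sigma> (f u) (g u)) \<Longrightarrow>
    has_value \<sigma> (\<Prod>u\<in>A. f u) (\<Prod>u\<in>A. g u)"
  by (induction A rule: finite_induct) (simp_all add: has_value_1 has_value_mult)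

lemmas has_value_intros = has_value_var has_value_1 has_value_add has_value_diff has_value_mult
  has_value_divide has_value_power has_value_uminus

text \<open>Zero only has the value zero. One nonzero value at a complex point therefore certifies
  that an element of \<open>K\<close> is nonzero.\<close>

lemma nonzero_if_has_value: "has_value \<sigma> f z \<Longrightarrow> z \<noteq> 0 \<Longrightarrow> f \<noteq> 0"
  using has_value_unique has_value_0 by blast

end

interpretation point: coefficient_hom "\<lambda>z. z"
  by standard simp_all

interpretation subst: coefficient_hom const
  by standard (simp_all add: const_def mult_single single_add One_fract_def)

lemma var_prod: "(\<Prod>v\<in>UNIV. var v ^ Poly_Mapping.lookup m v) = Fract (Poly_Mapping.single m 1) 1"
proof -
  have power: "var v ^ n = Fract (Poly_Mapping.single (Poly_Mapping.single v n) 1) 1" for v n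
    by (induction n) (simp_all add: One_fract_def var_def mult_single flip: single_add)
  have "(\<Prod>v\<in>A. var v ^ Poly_Mapping.lookup m v) =
      Fract (Poly_Mapping.single (\<Sum>v\<in>A. Poly_Mapping.single v (Poly_Mapping.lookup m v)) 1) 1"
    if "finite A" for A
    using that by (induction A rule: finite_induct) (simp_all add: One_fract_def power mult_single)
  moreover have "(\<Sum>v\<in>UNIV. Poly_Mapping.single v (Poly_Mapping.lookup m v)) = m"
    by (intro poly_mapping_eqI) (simp add: lookup_sum lookup_single when_def)
  ultimately show ?thesis by simp
qed

text \<open>Identifies the embedding of polynomials into \<open>K\<close> as a polynomial expression
  in the \<open>var v\<close>, to which automorphisms can be applied term by term.\<close>

lemma eval_var: "subst.eval var p = Fract p 1"
proof (induction p rule: poly_mapping_plus_induct)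
  case (add p m a)
  have "subst.eval var (Poly_Mapping.single m a) = Fract (Poly_Mapping.single m a) 1"
    unfolding subst.eval_single var_prod by (simp add: const_def mult_single)
  with add show ?case by (simp add: subst.eval_add)
qed (simp add: Zero_fract_def)

text \<open>Composition of substitutions: \<open>\<rho> v\<close> is the result of applying
  \<open>\<tau>\<close> to \<open>\<sigma> v\<close>. Only ring operations occur, so no further
  denominators have to be controlled.\<close>

lemma has_value_eval:
  assumes "\<And>v. subst.has_value \<tau> (\<sigma> v) (\<rho> v)"
  shows "subst.has_value \<tau> (subst.eval \<sigma> p) (subst.eval \<rho> p)"
proof (induction p rule: poly_mapping_plus_induct)
  case zero
  show ?case by (simp add: subst.has_value_0)
next
  case (add p m a)
  have "subst.has_value \<tau> (subst.eval \<sigma> (Poly_Mapping.single m a))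
      (subst.eval \<rho> (Poly_Mapping.single m a))"
    unfolding subst.eval_single
    by (intro subst.has_value_mult subst.has_value_const subst.has_value_prod
        subst.has_value_power assms finite)
  with add show ?case unfolding subst.eval_add by (rule subst.has_value_add)
qed

subsection \<open>Automorphisms given by the images of the indeterminates\<close>

lemma C_automorphism_0: "C_automorphism \<phi> \<Longrightarrow> \<phi> 0 = 0"
  unfolding C_automorphism_def by (metis add_cancel_right_right)

lemma C_automorphism_1: "C_automorphism \<phi> \<Longrightarrow> \<phi> 1 = 1"
  unfolding C_automorphism_def by (metis subst.\<kappa>_1)

lemma C_automorphism_add: "C_automorphism \<phi> \<Longrightarrow> \<phi> (f + g) = \<phi> f + \<phi> g"
  by (simp add: C_automorphism_def)

lemma C_automorphism_mult: "C_automorphism \<phi> \<Longrightarrow> \<phi> (f * g) = \<phi> f * \<phi> g"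
  by (simp add: C_automorphism_def)

lemma C_automorphism_uminus: "C_automorphism \<phi> \<Longrightarrow> \<phi> (- f) = - \<phi> f"
  using C_automorphism_add[of \<phi> "- f" f] C_automorphism_0[of \<phi>]
  by (simp add: eq_neg_iff_add_eq_0)

lemma C_automorphism_diff: "C_automorphism \<phi> \<Longrightarrow> \<phi> (f - g) = \<phi> f - \<phi> g"
  using C_automorphism_add[of \<phi> f "- g"] C_automorphism_uminus[of \<phi> g] by simp

lemma C_automorphism_inverse: "C_automorphism \<phi> \<Longrightarrow> \<phi> (inverse f) = inverse (\<phi> f)"
  using C_automorphism_mult[of \<phi> f "inverse f"]
  by (cases "f = 0")
    (simp_all add: C_automorphism_0 C_automorphism_1 inverse_unique)

lemma C_automorphism_divide: "C_automorphism \<phi> \<Longrightarrow> \<phi> (f / g) = \<phi> f / \<phi> g"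
  by (simp add: divide_inverse C_automorphism_mult C_automorphism_inverse)

lemma C_automorphism_power: "C_automorphism \<phi> \<Longrightarrow> \<phi> (f ^ n) = \<phi> f ^ n"
  by (induction n) (simp_all add: C_automorphism_1 C_automorphism_mult)

lemma C_automorphism_prod:
  "finite A \<Longrightarrow> C_automorphism \<phi> \<Longrightarrow> \<phi> (\<Prod>u\<in>A. f u) = (\<Prod>u\<in>A. \<phi> (f u))"
  by (induction A rule: finite_induct) (simp_all add: C_automorphism_1 C_automorphism_mult)

lemma C_automorphism_eval_var:
  assumes "C_automorphism \<phi>"
  shows "\<phi> (subst.eval var p) = subst.eval (\<lambda>v. \<phi> (var v)) p"
proof (induction p rule: poly_mapping_plus_induct)
  case (add p m a)
  have "\<phi> (const a) = const a" using assms by (simp add: C_automorphism_def)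
  with add show ?case
    by (simp add: assms subst.eval_add subst.eval_single C_automorphism_add C_automorphism_mult
        C_automorphism_prod C_automorphism_power)
qed (simp add: C_automorphism_0 assms)

text \<open>Every element of \<open>K\<close> is a quotient of polynomials in the
  \<open>var v\<close>, so their images determine an automorphism. This gives the definite
  description in \<open>automorphism\<close> its uniqueness.\<close>

lemma acts_by_unique:
  assumes "acts_by \<phi> \<sigma>" and "acts_by \<psi> \<sigma>"
  shows "\<phi> = \<psi>"
proof
  fix f :: K
  obtain p q where "f = Fract p q" by (cases f) auto
  then have f: "f = subst.eval var p / subst.eval var q" by (simp add: eval_var)
  show "\<phi> f = \<psi> f"
    using assms by (simp add: f acts_by_def C_automorphism_divide C_automorphism_eval_var)
qed

lemma automorphism_eqI: "acts_by \<phi> \<sigma> \<Longrightarrow> automorphism \<sigma> = \<phi>"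
  unfolding automorphism_def using acts_by_unique by blast

section \<open>Extension of invertible substitutions to the whole field\<close>

lemma has_value_eval_left_inverse:
  assumes "\<And>v. subst.has_value \<tau> (\<sigma> v) (var v)"
  shows "subst.has_value \<tau> (subst.eval \<sigma> p) (Fract p 1)"
  using has_value_eval[of \<tau> \<sigma> var p, OF assms] by (simp only: eval_var)

text \<open>Otherwise zero would have the value \<open>Fract q 1\<close> under
  \<open>\<tau>\<close>.\<close>

lemma eval_neq_0:
  assumes "\<And>v. subst.has_value \<tau> (\<sigma> v) (var v)" and "q \<noteq> 0"
  shows "subst.eval \<sigma> q \<noteq> 0"
proof
  assume "subst.eval \<sigma> q = 0"
  then have "subst.has_value \<tau> 0 (Fract q 1)"
    using has_value_eval_left_inverse[of \<tau> \<sigma> q, OF assms(1)] by (simp only:)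
  then have "Fract q 1 = 0" using subst.has_value_0 subst.has_value_unique by blast
  then show False using assms(2) by (simp add: Zero_fract_def eq_fract)
qed

lemma has_value_total:
  assumes "\<And>v. subst.has_value \<tau> (\<sigma> v) (var v)"
  obtains \<phi> where "\<And>f. subst.has_value \<sigma> f (\<phi> f)"
proof -
  have "\<exists>z. subst.has_value \<sigma> f z" for f
  proof -
    obtain p q where f: "f = Fract p q" "q \<noteq> 0" by (cases f) auto
    have "subst.eval \<sigma> q \<noteq> 0" by (rule eval_neq_0[of \<tau>]) fact+
    then show ?thesis using f(1) subst.has_value_Fract by blast
  qed
  then show thesis using that by metis
qed

text \<open>On \<open>p / q\<close>, \<open>\<phi>\<close> gives the quotient of \<open>p\<close>
  and \<open>q\<close> evaluated at \<open>\<sigma>\<close>, and \<open>\<tau>\<close> carries these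
  two back to \<open>p\<close> and \<open>q\<close>.\<close>

lemma substitution_left_inverse:
  assumes \<sigma>: "\<And>v. subst.has_value \<tau> (\<sigma> v) (var v)"
    and \<phi>: "\<And>f. subst.has_value \<sigma> f (\<phi> f)" and \<psi>: "\<And>f. subst.has_value \<tau> f (\<psi> f)"
  shows "\<psi> (\<phi> f) = f"
proof -
  obtain p q where f: "f = Fract p q" "q \<noteq> 0" by (cases f) auto
  have q: "subst.eval \<sigma> q \<noteq> 0" by (rule eval_neq_0[of \<tau>, OF \<sigma> f(2)])
  have "subst.has_value \<sigma> f (subst.eval \<sigma> p / subst.eval \<sigma> q)"
    unfolding f(1) by (rule subst.has_value_Fract[OF q])
  then have "\<phi> f = subst.eval \<sigma> p / subst.eval \<sigma> q"
    by (rule subst.has_value_unique[OF \<phi>])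
  moreover have "subst.has_value \<tau> (subst.eval \<sigma> p / subst.eval \<sigma> q) (Fract p 1 / Fract q 1)"
    by (rule subst.has_value_divide has_value_eval_left_inverse[of \<tau> \<sigma>, OF \<sigma>])+
      (use f(2) in \<open>simp add: Zero_fract_def eq_fract\<close>)
  moreover have "Fract p 1 / Fract q 1 = f" by (simp add: f(1))
  ultimately have "subst.has_value \<tau> (\<phi> f) f" by simp
  with \<psi> show ?thesis by (rule subst.has_value_unique)
qed

text \<open>The hypotheses concern the twelve indeterminates only. The first makes
  \<open>\<sigma>\<close> defined on all of \<open>K\<close>, the second \<open>\<tau>\<close>, and
  together they make the two extensions mutually inverse.\<close>

lemma acts_by_if_inverse:
  assumes \<sigma>: "\<And>v. subst.has_value \<tau> (\<sigma> v) (var v)"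
    and \<tau>: "\<And>v. subst.has_value \<sigma> (\<tau> v) (var v)"
  shows "acts_by (automorphism \<sigma>) \<sigma>" and "inv (automorphism \<sigma>) = automorphism \<tau>"
proof -
  \<comment> \<open>Stated for any \<open>\<sigma>\<close>, so that it serves for both
    substitutions.\<close>
  have acts: "acts_by \<phi> \<sigma>"
    if \<phi>: "\<And>f. subst.has_value \<sigma> f (\<phi> f)" and inverse: "\<And>f. \<psi> (\<phi> f) = f" "\<And>f. \<phi> (\<psi> f) = f"
    for \<phi> \<psi> \<sigma>
  proof -
    have "bij \<phi>" using inverse by (intro o_bij[of \<psi>]) (auto simp: fun_eq_iff)
    moreover have "\<phi> f = z" if "subst.has_value \<sigma> f z" for f z
      using subst.has_value_unique \<phi> that by blast
    ultimately show ?thesis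
      by (simp add: acts_by_def C_automorphism_def \<phi> subst.has_value_add subst.has_value_mult
          subst.has_value_const subst.has_value_var)
  qed
  obtain \<phi> where \<phi>: "\<And>f. subst.has_value \<sigma> f (\<phi> f)"
    using has_value_total[OF \<sigma>] by blast
  obtain \<psi> where \<psi>: "\<And>f. subst.has_value \<tau> f (\<psi> f)"
    using has_value_total[OF \<tau>] by blast
  have inverse: "\<psi> (\<phi> f) = f" "\<phi> (\<psi> f) = f" for f
    using substitution_left_inverse[of \<tau> \<sigma> \<phi> \<psi>, OF \<sigma> \<phi> \<psi>] substitution_left_inverse[of \<sigma> \<tau> \<psi> \<phi>, OF \<tau> \<psi> \<phi>] by simp_all
  have "acts_by \<phi> \<sigma>" "acts_by \<psi> \<tau>"
    using acts[of \<sigma> \<phi> \<psi>, OF \<phi> inverse] acts[of \<tau> \<psi> \<phi>, OF \<psi> inverse(2,1)] by simp_all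
  then have "automorphism \<sigma> = \<phi>" "automorphism \<tau> = \<psi>" by (simp_all add: automorphism_eqI)
  moreover have "inv \<phi> = \<psi>" using inverse by (intro inv_equality)
  ultimately show "acts_by (automorphism \<sigma>) \<sigma>" and "inv (automorphism \<sigma>) = automorphism \<tau>"
    using \<open>acts_by \<phi> \<sigma>\<close> by auto
qed

lemma C_automorphism_comp:
  "C_automorphism \<phi> \<Longrightarrow> C_automorphism \<psi> \<Longrightarrow> C_automorphism (\<phi> \<circ> \<psi>)"
  by (simp add: C_automorphism_def bij_comp)

text \<open>
  Comparing \<open>\<psi> (\<tau> v)\<close> with \<open>s (\<psi> v)\<close> needs two nested substitutions only, whereas computing
  \<open>\<phi> (s (\<psi> v))\<close> needs three.
\<close>

lemma acts_by_conjugate: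
  assumes "C_automorphism \<phi>" and "C_automorphism \<psi>" and "inv \<phi> = \<psi>" and "C_automorphism s"
    and "\<And>v. \<psi> (\<tau> v) = s (\<psi> (var v))"
  shows "acts_by (\<phi> \<circ> s \<circ> inv \<phi>) \<tau>"
proof -
  \<comment> \<open>Applying \<open>\<phi>\<close> to the last hypothesis then gives
    \<open>\<tau> v = \<phi> (s (\<psi> (var v)))\<close>.\<close>
  have "\<phi> (\<psi> f) = f" for f
    using assms(1,3) unfolding C_automorphism_def by (metis bij_inv_eq_iff)
  then show ?thesis
    using assms by (auto simp: acts_by_def C_automorphism_comp simp flip: assms(5))
qed

text \<open>An arbitrary point at which none of the denominators below vanishes.\<close>

fun sample_point :: "gen \<Rightarrow> complex" where
  "sample_point E1 = 2" | "sample_point E2 = 3" | "sample_point E3 = 5" | "sample_point E4 = 7"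
| "sample_point E5 = 11" | "sample_point E6 = 13" | "sample_point E7 = 17" | "sample_point E8 = 19"
| "sample_point H1 = 23" | "sample_point H2 = 29" | "sample_point X = 31" | "sample_point Y = 37"

lemmas nonzero_by_sampling = point.nonzero_if_has_value[where \<sigma> = sample_point]

lemma var_nonzero [simp]: "var v \<noteq> 0"
  by (rule nonzero_by_sampling, rule point.has_value_var) (cases v; simp)

text \<open>The introduction rules build a value in unsimplified form; its comparison with the
  expected value becomes a separate goal.\<close>

lemma has_value_eqI: "subst.has_value \<sigma> f w \<Longrightarrow> w = z \<Longrightarrow> subst.has_value \<sigma> f z"
  by simp

subsection \<open>The rational identities\<close>

text \<open>A function over an arbitrary field with the parameters as arguments: images under
  substitutions are again instances, and the identities below involve free variables only.\<close>

definition s4_x :: "'a::field \<Rightarrow> 'a \<Rightarrow> 'a \<Rightarrow> 'a \<Rightarrow> 'a \<Rightarrow> 'a \<Rightarrow> 'a" where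
  "s4_x u4 u5 k1 k2 x y =
    (u4 * (k1 - k2) * x + k2 * (u4 * u5 - k1) * x * y - k1 * (u4 * u5 - k2)) /
    (u4 * (u4 * u5 - k2) * x * y - u4 * (u4 * u5 - k1) - u4 * u5 * (k1 - k2) * y)"

definition phi12_x :: "'a::field \<Rightarrow> 'a \<Rightarrow> 'a \<Rightarrow> 'a \<Rightarrow> 'a \<Rightarrow> 'a" where
  "phi12_x u3 u4 k2 x y =
    k2 * ((u3 + u4) * x - u3 * u4 + k2 - x * y) / ((u3 + u4) * k2 + (u3 * u4 - k2) * x - u3 * u4 * y)"

text \<open>
  Obtained by applying the inverse of \<open>\<phi>\<^sub>1\<^sub>2\<close> to the formula for \<open>\<phi>\<^sub>1\<^sub>2 x\<close> and solving for the image of \<open>y\<close>.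
\<close>

definition psi_y :: "'a::field \<Rightarrow> 'a \<Rightarrow> 'a \<Rightarrow> 'a \<Rightarrow> 'a \<Rightarrow> 'a \<Rightarrow> 'a" where
  "psi_y u3 u4 k1 k2 x y =
    (k1 * k2 * (u3 + u4 + (k1 - k2) * y - (u3 + u4) * x * y) - (k2 - k1) * u3 * u4 * x) /
    (u3 * u4 * (k1 - k2 * x * y))"

text \<open>Cleared of denominators, the definition of \<open>w\<close> is a linear equation for
  \<open>w\<close>, and the claim is a polynomial consequence of it. The new parameters are the
  images of \<open>e4\<close>, \<open>e5\<close>, \<open>h1\<close> under \<open>mu E4 E5\<close>,
  so \<open>s1 4\<close> is an involution on \<open>x\<close>. The other identities with an
  auxiliary \<open>w\<close> are proved in the same way.\<close>

lemma s4_x_involution: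
  fixes u4 u5 k1 k2 x y :: "'a::field"
  defines "w \<equiv> s4_x u4 u5 k1 k2 x y"
  assumes nz: "u4 \<noteq> 0" "u5 \<noteq> 0" "k2 \<noteq> 0"
    and den: "u4 * (u4 * u5 - k2) * x * y - u4 * (u4 * u5 - k1) - u4 * u5 * (k1 - k2) * y \<noteq> 0"
    and den': "k2 / u5 * (k2 / u5 * (k2 / u4) - k2) * w * y - k2 / u5 * (k2 / u5 * (k2 / u4) - k1 * k2 / (u4 * u5))
       - k2 / u5 * (k2 / u4) * (k1 * k2 / (u4 * u5) - k2) * y \<noteq> 0"
  shows "s4_x (k2 / u5) (k2 / u4) (k1 * k2 / (u4 * u5)) k2 w y = x"
proof -
  have w: "w * (u4 * (u4 * u5 - k2) * x * y - u4 * (u4 * u5 - k1) - u4 * u5 * (k1 - k2) * y) =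
    u4 * (k1 - k2) * x + k2 * (u4 * u5 - k1) * x * y - k1 * (u4 * u5 - k2)"
    using den by (simp add: w_def s4_x_def)
  show ?thesis
    unfolding s4_x_def nonzero_divide_eq_eq[OF den']
    using nz by (simp add: divide_simps) (use w in algebra)
qed

text \<open>The arguments are the images of \<open>e3\<close>, \<open>e4\<close>, \<open>h2\<close>,
  \<open>x\<close>, \<open>y\<close> under the inverse of \<open>phi12\<close>: substituting them
  into the image of \<open>x\<close> under \<open>phi12\<close> must give back
  \<open>x\<close>.\<close>

lemma phi12_x_psi:
  fixes u3 u4 k1 k2 x y :: "'a::field"
  defines "w \<equiv> psi_y u3 u4 k1 k2 x y"
  assumes nz: "u3 \<noteq> 0" "u4 \<noteq> 0" "k2 \<noteq> 0" "y \<noteq> 0"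
    and den: "k1 - k2 * x * y \<noteq> 0"
    and den': "(k2 / u3 + k2 / u4) * (k1 * k2 / (u3 * u4)) + (k2 / u3 * (k2 / u4) - k1 * k2 / (u3 * u4)) * (1 / y) - k2 / u3 * (k2 / u4) * w \<noteq> 0"
  shows "phi12_x (k2 / u3) (k2 / u4) (k1 * k2 / (u3 * u4)) (1 / y) w = x"
proof -
  have w: "w * (u3 * u4 * (k1 - k2 * x * y)) =
    k1 * k2 * (u3 + u4 + (k1 - k2) * y - (u3 + u4) * x * y) - (k2 - k1) * u3 * u4 * x"
    using nz den by (simp add: w_def psi_y_def)
  show ?thesis
    unfolding phi12_x_def nonzero_divide_eq_eq[OF den']
    using nz by (simp add: divide_simps) (use w in algebra)
qed

text \<open>The converse check for \<open>y\<close>: the arguments are the images of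
  \<open>e3\<close>, \<open>e4\<close>, \<open>h1\<close>, \<open>h2\<close>, \<open>x\<close>,
  \<open>y\<close> under \<open>phi12\<close>.\<close>

lemma psi_y_phi12:
  fixes u3 u4 k1 k2 x y :: "'a::field"
  defines "w \<equiv> phi12_x u3 u4 k2 x y"
  assumes nz: "u3 \<noteq> 0" "u4 \<noteq> 0" "k1 \<noteq> 0" "k2 \<noteq> 0" "x \<noteq> 0"
    and den: "(u3 + u4) * k2 + (u3 * u4 - k2) * x - u3 * u4 * y \<noteq> 0"
    and den': "k1 * k2 / (u3 * u4) - k1 * w * (1 / x) \<noteq> 0"
  shows "psi_y (k1 / u3) (k1 / u4) (k1 * k2 / (u3 * u4)) k1 w (1 / x) = y"
proof -
  have w: "w * ((u3 + u4) * k2 + (u3 * u4 - k2) * x - u3 * u4 * y) =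
    k2 * ((u3 + u4) * x - u3 * u4 + k2 - x * y)"
    using nz den by (simp add: w_def phi12_x_def)
  have den'': "k1 / u3 * (k1 / u4) * (k1 * k2 / (u3 * u4) - k1 * w * (1 / x)) \<noteq> 0"
    using nz den' by simp
  show ?thesis
    unfolding psi_y_def nonzero_divide_eq_eq[OF den'']
    using nz by (simp add: divide_simps) (use w in algebra)
qed

lemma psi_y_commute: "psi_y u4 u3 k1 k2 x y = psi_y u3 u4 k1 k2 x y"
  by (simp add: psi_y_def ac_simps)

text \<open>Invariance under \<open>s1 0\<close> of the image of \<open>y\<close> under the inverse
  of \<open>phi12\<close>; this is why \<open>s2 0\<close> fixes \<open>y\<close>.\<close>

lemma psi_y_s0:
  fixes u3 u4 k1 k2 x y :: "'a::field"
  assumes nz: "u3 \<noteq> 0" "u4 \<noteq> 0" "x \<noteq> 0" "y \<noteq> 0" and den: "k1 - k2 * x * y \<noteq> 0"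
  shows "psi_y u3 u4 k2 k1 (1 / y) (1 / x) = psi_y u3 u4 k1 k2 x y"
proof -
  have "k2 - k1 * (1 / y) * (1 / x) \<noteq> 0"
    using nz den by (simp add: divide_simps) (simp add: ac_simps)
  with nz have den': "u3 * u4 * (k2 - k1 * (1 / y) * (1 / x)) \<noteq> 0" by simp
  have den'': "u3 * u4 * (k1 - k2 * x * y) \<noteq> 0" using nz den by simp
  show ?thesis
    unfolding psi_y_def frac_eq_eq[OF den' den'']
    using nz by (simp add: divide_simps) algebra
qed

text \<open>Here \<open>E\<close>, \<open>k2\<close>, \<open>H\<close>, \<open>1 / y\<close>,
  \<open>w\<close> are the images of \<open>e3\<close>, \<open>h1\<close>, \<open>h2\<close>,
  \<open>x\<close>, \<open>y\<close> under the inverse of \<open>phi12\<close>. The right-hand side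
  is \<open>w\<close> after the exchange of \<open>u2\<close> and \<open>u3\<close>.\<close>

lemma psi_y_s2:
  fixes u2 u3 u4 k1 k2 x y :: "'a::field"
  defines "E \<equiv> k2 / u3" and "H \<equiv> k1 * k2 / (u3 * u4)" and "w \<equiv> psi_y u3 u4 k1 k2 x y"
  assumes nz: "u2 \<noteq> 0" "u3 \<noteq> 0" "u4 \<noteq> 0" "k2 \<noteq> 0" "y \<noteq> 0"
    and den: "k1 - k2 * x * y \<noteq> 0" and den': "1 / y - E \<noteq> 0"
  shows "(u2 * E * (1 / y) * w - E * (u2 * E - k2) * (1 / y) - E * k2 * w - H * (u2 * E - k2)) /
             (u2 * E * (1 / y - E)) = psi_y u2 u4 k1 k2 x y"
proof -
  have w: "w * (u3 * u4 * (k1 - k2 * x * y)) =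
    k1 * k2 * (u3 + u4 + (k1 - k2) * y - (u3 + u4) * x * y) - (k2 - k1) * u3 * u4 * x"
    using nz den by (simp add: w_def psi_y_def)
  have d1: "u2 * E * (1 / y - E) \<noteq> 0" using nz den' by (simp add: E_def)
  have d2: "u2 * u4 * (k1 - k2 * x * y) \<noteq> 0" using nz den by simp
  show ?thesis
    unfolding psi_y_def frac_eq_eq[OF d1 d2]
    using nz by (simp add: divide_simps E_def H_def) (use w in algebra)
qed

text \<open>Invariance under \<open>s1 4\<close> of the image of \<open>y\<close> under the inverse
  of \<open>phi12\<close>; this is why \<open>s2 4\<close> fixes \<open>y\<close> although
  \<open>s1 4\<close> moves \<open>x\<close>.\<close>

lemma psi_y_s4:
  fixes u3 u4 u5 k1 k2 x y :: "'a::field"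
  defines "w \<equiv> s4_x u4 u5 k1 k2 x y"
  assumes nz: "u3 \<noteq> 0" "u4 \<noteq> 0" "u5 \<noteq> 0" "k2 \<noteq> 0"
    and den: "u4 * (u4 * u5 - k2) * x * y - u4 * (u4 * u5 - k1) - u4 * u5 * (k1 - k2) * y \<noteq> 0"
    and d1: "k1 - k2 * x * y \<noteq> 0"
    and d2: "k1 * k2 / (u4 * u5) - k2 * w * y \<noteq> 0"
  shows "psi_y u3 (k2 / u5) (k1 * k2 / (u4 * u5)) k2 w y = psi_y u3 u4 k1 k2 x y"
proof -
  have w: "w * (u4 * (u4 * u5 - k2) * x * y - u4 * (u4 * u5 - k1) - u4 * u5 * (k1 - k2) * y) =
    u4 * (k1 - k2) * x + k2 * (u4 * u5 - k1) * x * y - k1 * (u4 * u5 - k2)"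
    using den by (simp add: w_def s4_x_def)
  have d1': "u3 * u4 * (k1 - k2 * x * y) \<noteq> 0" using nz d1 by simp
  have d2': "u3 * (k2 / u5) * (k1 * k2 / (u4 * u5) - k2 * w * y) \<noteq> 0" using nz d2 by simp
  show ?thesis
    unfolding psi_y_def frac_eq_eq[OF d2' d1']
    using nz by (simp add: divide_simps) (use w in algebra)
qed


text \<open>The local \<open>b1\<close>, ..., \<open>b4\<close> are the elementary symmetric
  functions; they are identified with polynomial coefficients only at the end.\<close>

definition pi2_y :: "'a::field \<Rightarrow> 'a \<Rightarrow> 'a \<Rightarrow> 'a \<Rightarrow> 'a \<Rightarrow> 'a \<Rightarrow> 'a \<Rightarrow> 'a \<Rightarrow> 'a" where
  "pi2_y u3 u4 u5 u6 k1 k2 x y =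
    (let b1 = u3 + u4 + u5 + u6;
         b2 = u3 * u4 + u3 * u5 + u3 * u6 + u4 * u5 + u4 * u6 + u5 * u6;
         b3 = u3 * u4 * u5 + u3 * u4 * u6 + u3 * u5 * u6 + u4 * u5 * u6;
         b4 = u3 * u4 * u5 * u6
     in k1 * (k2 * x ^ 2 * y - k2 * b1 * x ^ 2 - (b4 - k2 * b2 + k2 ^ 2) * x + b4 * y - k2 * b3) /
          (b4 * (x * y - x ^ 2 - k2)))"

text \<open>On the left, the inverse of \<open>phi12\<close> is applied to the claimed image of
  \<open>y\<close> under \<open>pi2\<close>; on the right, \<open>pi1\<close> is applied to the
  image of \<open>y\<close> under that inverse.\<close>

lemma psi_y_pi1:
  fixes u3 u4 u5 u6 k1 k2 x y :: "'a::field"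
  defines "w \<equiv> psi_y u3 u4 k1 k2 x y"
  assumes nz: "u3 \<noteq> 0" "u4 \<noteq> 0" "u5 \<noteq> 0" "u6 \<noteq> 0" "k1 \<noteq> 0" "k2 \<noteq> 0" "x \<noteq> 0" "y \<noteq> 0"
    and den: "k1 - k2 * x * y \<noteq> 0"
    and d1: "1 / y * w - (1 / y) ^ 2 - k1 * k2 / (u3 * u4) \<noteq> 0"
    and d2: "k1 - k2 * (k1 / x) * (1 / (k2 * y)) \<noteq> 0"
  shows "pi2_y (k2 / u3) (k2 / u4) u5 u6 k2 (k1 * k2 / (u3 * u4)) (1 / y) w =
    psi_y u6 u5 k1 k2 (k1 / x) (1 / (k2 * y))"
proof -
  have w: "w * (u3 * u4 * (k1 - k2 * x * y)) =
    k1 * k2 * (u3 + u4 + (k1 - k2) * y - (u3 + u4) * x * y) - (k2 - k1) * u3 * u4 * x"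
    using nz den by (simp add: w_def psi_y_def)
  have d1': "k2 / u3 * (k2 / u4) * u5 * u6 * (1 / y * w - (1 / y) ^ 2 - k1 * k2 / (u3 * u4)) \<noteq> 0"
    using nz d1 by simp
  have d2': "u6 * u5 * (k1 - k2 * (k1 / x) * (1 / (k2 * y))) \<noteq> 0" using nz d2 by simp
  show ?thesis
    unfolding psi_y_def pi2_y_def Let_def frac_eq_eq[OF d1' d2']
    using nz by (simp add: divide_simps power2_eq_square) (use w in algebra)
qed

subsection \<open>The generators of the first representation\<close>

text \<open>A transposition is its own inverse, so \<open>r i j\<close> fills both roles in a pair
  of inverse substitutions.\<close>

lemma has_value_r: "subst.has_value (r i j) (r i j v) (var v)"
proof -
  define w where "w = (if v = j then i else if v = i then j else v)"
  have "r i j v = var w" and "r i j w = var v" by (auto simp: r_def w_def)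
  then show ?thesis using subst.has_value_var[of "r i j" w] by simp
qed

definition s0_images :: "gen \<Rightarrow> K" where
  "s0_images = c(X := 1 / \<y>, Y := 1 / \<x>)"

definition s4_images :: "gen \<Rightarrow> K" where
  "s4_images = (mu E4 E5)(X := s4_x e4 e5 h1 h2 \<x> \<y>)"

definition pi1_images :: "gen \<Rightarrow> K" where
  "pi1_images = var(E1 := e8, E2 := e7, E3 := e6, E4 := e5, E5 := e4, E6 := e3, E7 := e2, E8 := e1,
     X := h1 / \<x>, Y := 1 / (h2 * \<y>))"

definition phi_images :: "gen \<Rightarrow> K" where
  "phi_images = var(X := phi12_x e3 e4 h2 \<x> \<y>, Y := 1 / \<x>,
     E3 := h1 / e3, E4 := h1 / e4, H1 := h1 * h2 / (e3 * e4), H2 := h1)"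

text \<open>Obtained by solving the equations for \<open>phi12\<close>: \<open>Y\<close> going to
  \<open>1 / \<x>\<close> and \<open>H2\<close> going to \<open>h1\<close> give the images of
  \<open>X\<close> and \<open>H1\<close>; those of \<open>E3\<close>, \<open>E4\<close> and then
  \<open>H2\<close> follow.\<close>

definition psi_images :: "gen \<Rightarrow> K" where
  "psi_images = var(X := 1 / \<y>, Y := psi_y e3 e4 h1 h2 \<x> \<y>,
     E3 := h2 / e3, E4 := h2 / e4, H1 := h2, H2 := h1 * h2 / (e3 * e4))"

lemma s0_images_simps [simp]:
  "s0_images E1 = e1" "s0_images E2 = e2" "s0_images E3 = e3" "s0_images E4 = e4"
  "s0_images E5 = e5" "s0_images E6 = e6" "s0_images E7 = e7" "s0_images E8 = e8"
  "s0_images H1 = h2" "s0_images H2 = h1" "s0_images X = 1 / \<y>" "s0_images Y = 1 / \<x>"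
  by (simp_all add: s0_images_def c_def)

lemma s4_images_simps [simp]:
  "s4_images E1 = e1" "s4_images E2 = e2" "s4_images E3 = e3" "s4_images E4 = h2 / e5"
  "s4_images E5 = h2 / e4" "s4_images E6 = e6" "s4_images E7 = e7" "s4_images E8 = e8"
  "s4_images H1 = h1 * h2 / (e4 * e5)" "s4_images H2 = h2"
  "s4_images X = s4_x e4 e5 h1 h2 \<x> \<y>" "s4_images Y = \<y>"
  by (simp_all add: s4_images_def mu_def)

lemma pi1_images_simps [simp]:
  "pi1_images E1 = e8" "pi1_images E2 = e7" "pi1_images E3 = e6" "pi1_images E4 = e5"
  "pi1_images E5 = e4" "pi1_images E6 = e3" "pi1_images E7 = e2" "pi1_images E8 = e1"
  "pi1_images H1 = h1" "pi1_images H2 = h2"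
  "pi1_images X = h1 / \<x>" "pi1_images Y = 1 / (h2 * \<y>)"
  by (simp_all add: pi1_images_def)

lemma phi_images_simps [simp]:
  "phi_images E1 = e1" "phi_images E2 = e2" "phi_images E3 = h1 / e3" "phi_images E4 = h1 / e4"
  "phi_images E5 = e5" "phi_images E6 = e6" "phi_images E7 = e7" "phi_images E8 = e8"
  "phi_images H1 = h1 * h2 / (e3 * e4)" "phi_images H2 = h1"
  "phi_images X = phi12_x e3 e4 h2 \<x> \<y>" "phi_images Y = 1 / \<x>"
  by (simp_all add: phi_images_def)

lemma psi_images_simps [simp]:
  "psi_images E1 = e1" "psi_images E2 = e2" "psi_images E3 = h2 / e3" "psi_images E4 = h2 / e4"
  "psi_images E5 = e5" "psi_images E6 = e6" "psi_images E7 = e7" "psi_images E8 = e8"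
  "psi_images H1 = h2" "psi_images H2 = h1 * h2 / (e3 * e4)"
  "psi_images X = 1 / \<y>" "psi_images Y = psi_y e3 e4 h1 h2 \<x> \<y>"
  by (simp_all add: psi_images_def)

section \<open>Nonvanishing denominators and pairs of inverse substitutions\<close>

lemma s4_x_den_nonzero:
  "e4 * (e4 * e5 - h2) * \<x> * \<y> - e4 * (e4 * e5 - h1) - e4 * e5 * (h1 - h2) * \<y> \<noteq> 0"
  by (rule nonzero_by_sampling, (rule point.has_value_intros | simp)+)

lemma phi12_x_den_nonzero: "(e3 + e4) * h2 + (e3 * e4 - h2) * \<x> - e3 * e4 * \<y> \<noteq> 0"
  by (rule nonzero_by_sampling, (rule point.has_value_intros | simp)+)

lemma psi_y_den_nonzero: "h1 - h2 * \<x> * \<y> \<noteq> 0"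
  by (rule nonzero_by_sampling, (rule point.has_value_intros | simp)+)

lemma has_value_s0: "subst.has_value s0_images (s0_images v) (var v)"
  by (cases v; simp; (rule has_value_eqI, (rule subst.has_value_intros | simp)+))

lemma has_value_pi1: "subst.has_value pi1_images (pi1_images v) (var v)"
  by (cases v; simp; (rule has_value_eqI, (rule subst.has_value_intros | simp)+))

lemma has_value_s4: "subst.has_value s4_images (s4_images v) (var v)"
proof (cases "v = X")
  case True
  have den: "h2 / e5 * (h2 / e5 * (h2 / e4) - h2) * s4_x e4 e5 h1 h2 \<x> \<y> * \<y> -
      h2 / e5 * (h2 / e5 * (h2 / e4) - h1 * h2 / (e4 * e5)) -
      h2 / e5 * (h2 / e4) * (h1 * h2 / (e4 * e5) - h2) * \<y> \<noteq> 0"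
    unfolding s4_x_def by (rule nonzero_by_sampling, (rule point.has_value_intros | simp)+)
  \<comment> \<open>Leaving each \<open>s4_images v\<close> unevaluated matches what
    \<open>has_value_var\<close> yields, so the rules apply directly and leave only the denominator
    condition, which \<open>den\<close> supplies.\<close>
  have "subst.has_value s4_images (s4_x e4 e5 h1 h2 \<x> \<y>)
      (s4_x (s4_images E4) (s4_images E5) (s4_images H1) (s4_images H2) (s4_images X) (s4_images Y))"
    unfolding s4_x_def[of e4] s4_x_def[of "s4_images E4"]
    by (rule subst.has_value_intros)+ (use den in simp)
  with True s4_x_involution[OF _ _ _ s4_x_den_nonzero den] show ?thesis by simp
next
  case False
  show ?thesis
    by (insert False, cases v; simp; (rule has_value_eqI, (rule subst.has_value_intros | simp)+))
qed

lemma has_value_phi_psi: "subst.has_value psi_images (phi_images v) (var v)"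
proof (cases "v = X")
  case True
  have den: "(h2 / e3 + h2 / e4) * (h1 * h2 / (e3 * e4)) +
      (h2 / e3 * (h2 / e4) - h1 * h2 / (e3 * e4)) * (1 / \<y>) -
      h2 / e3 * (h2 / e4) * psi_y e3 e4 h1 h2 \<x> \<y> \<noteq> 0"
    unfolding psi_y_def by (rule nonzero_by_sampling, (rule point.has_value_intros | simp)+)
  have "subst.has_value psi_images (phi12_x e3 e4 h2 \<x> \<y>)
      (phi12_x (psi_images E3) (psi_images E4) (psi_images H2) (psi_images X) (psi_images Y))"
    unfolding phi12_x_def
    by (rule subst.has_value_intros)+ (use den in simp)
  with True phi12_x_psi[OF _ _ _ _ psi_y_den_nonzero den] show ?thesis by simp
next
  case False
  show ?thesis
    by (insert False, cases v; simp; (rule has_value_eqI, (rule subst.has_value_intros | simp)+))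
qed

lemma has_value_psi_phi: "subst.has_value phi_images (psi_images v) (var v)"
proof (cases "v = Y")
  case True
  have den: "h1 * h2 / (e3 * e4) - h1 * phi12_x e3 e4 h2 \<x> \<y> * (1 / \<x>) \<noteq> 0"
    unfolding phi12_x_def by (rule nonzero_by_sampling, (rule point.has_value_intros | simp)+)
  have "subst.has_value phi_images (psi_y e3 e4 h1 h2 \<x> \<y>)
      (psi_y (phi_images E3) (phi_images E4) (phi_images H1) (phi_images H2) (phi_images X) (phi_images Y))"
    unfolding psi_y_def
    by (rule subst.has_value_intros)+ (use den in simp)
  with True psi_y_phi12[OF _ _ _ _ _ phi12_x_den_nonzero den] show ?thesis by simp
next
  case False
  show ?thesis
    by (insert False, cases v; simp; (rule has_value_eqI, (rule subst.has_value_intros | simp)+))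
qed

section \<open>The given maps as automorphisms\<close>

definition psi12 :: "K \<Rightarrow> K" where
  "psi12 = automorphism psi_images"

lemma phi12_eq: "phi12 = automorphism phi_images"
  by (simp add: phi12_def phi_images_def phi12_x_def)

lemma acts_by_phi12: "acts_by phi12 phi_images"
  unfolding phi12_eq by (rule acts_by_if_inverse has_value_phi_psi has_value_psi_phi)+

lemma acts_by_psi12: "acts_by psi12 psi_images"
  unfolding psi12_def by (rule acts_by_if_inverse has_value_phi_psi has_value_psi_phi)+

lemma inv_phi12: "inv phi12 = psi12"
  unfolding phi12_eq psi12_def by (rule acts_by_if_inverse has_value_phi_psi has_value_psi_phi)+

lemma acts_by_s1_0: "acts_by (s1 0) s0_images"
  using acts_by_if_inverse(1)[OF has_value_s0 has_value_s0]
  by (simp add: s1_def s1_images_def s0_images_def)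

lemma acts_by_s1_4: "acts_by (s1 4) s4_images"
  using acts_by_if_inverse(1)[OF has_value_s4 has_value_s4]
  by (simp add: s1_def s1_images_def s4_images_def s4_x_def)

lemma acts_by_pi1: "acts_by pi1 pi1_images"
  using acts_by_if_inverse(1)[OF has_value_pi1 has_value_pi1]
  by (simp add: pi1_def pi1_images_def)

lemma acts_by_s1_r:
  "acts_by (s1 1) (r E1 E2)" "acts_by (s1 2) (r E2 E3)" "acts_by (s1 3) (r E3 E4)"
  "acts_by (s1 5) (r E5 E6)" "acts_by (s1 6) (r E6 E7)" "acts_by (s1 7) (r E7 E8)"
  using acts_by_if_inverse(1)[OF has_value_r has_value_r] by (simp_all add: s1_def s1_images_def)

lemma acts_by_C_automorphism: "acts_by \<phi> \<sigma> \<Longrightarrow> C_automorphism \<phi>"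
  by (simp add: acts_by_def)

lemma acts_by_var: "acts_by \<phi> \<sigma> \<Longrightarrow> \<phi> (var v) = \<sigma> v"
  by (simp add: acts_by_def)

lemmas C_automorphism_homs = C_automorphism_1 C_automorphism_add C_automorphism_uminus
  C_automorphism_diff C_automorphism_mult C_automorphism_divide C_automorphism_power

lemma C_automorphism_psi_y:
  "C_automorphism \<phi> \<Longrightarrow>
    \<phi> (psi_y a b k l f g) = psi_y (\<phi> a) (\<phi> b) (\<phi> k) (\<phi> l) (\<phi> f) (\<phi> g)"
  by (simp add: psi_y_def C_automorphism_homs)

lemma C_automorphism_pi2_y:
  "C_automorphism \<phi> \<Longrightarrow> \<phi> (pi2_y a b m n k l f g) =
    pi2_y (\<phi> a) (\<phi> b) (\<phi> m) (\<phi> n) (\<phi> k) (\<phi> l) (\<phi> f) (\<phi> g)"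
  by (simp add: pi2_y_def Let_def C_automorphism_homs)

subsection \<open>The generators of the second representation\<close>

lemma acts_by_s2:
  assumes "acts_by (s1 i) \<sigma>" and "\<And>v. psi12 (\<tau> v) = s1 i (psi12 (var v))"
  shows "acts_by (s2 i) \<tau>"
  unfolding s2_def
  by (rule acts_by_conjugate[OF _ _ inv_phi12])
    (use acts_by_phi12 acts_by_psi12 assms in \<open>simp_all add: acts_by_def\<close>)

lemmas psi12_simps = acts_by_var[OF acts_by_psi12]
  C_automorphism_homs[OF acts_by_C_automorphism[OF acts_by_psi12]]

lemma acts_by_s2_0: "acts_by (s2 0) ((mu E3 E4)(X := phi12_x e3 e4 h2 \<x> \<y>))"
proof (rule acts_by_s2[OF acts_by_s1_0])
  note s1_simps = acts_by_var[OF acts_by_s1_0]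
    C_automorphism_homs[OF acts_by_C_automorphism[OF acts_by_s1_0]]
    C_automorphism_psi_y[OF acts_by_C_automorphism[OF acts_by_s1_0]]
  have "inj phi12" using acts_by_phi12 by (simp add: acts_by_def C_automorphism_def bij_def)
  \<comment> \<open>The claimed image of \<open>x\<close> is that of \<open>phi12\<close>, since
    \<open>s1 0\<close> sends \<open>psi12 \<x> = 1 / \<y>\<close> to \<open>\<x>\<close>.
    Cancelling \<open>phi12\<close> thus replaces a rational identity.\<close>
  then have "psi12 (phi12 \<x>) = \<x>" by (simp flip: inv_phi12)
  then have "psi12 (phi12_x e3 e4 h2 \<x> \<y>) = \<x>" by (simp add: acts_by_var[OF acts_by_phi12])
  then show "psi12 (((mu E3 E4)(X := phi12_x e3 e4 h2 \<x> \<y>)) v) = s1 0 (psi12 (var v))" for v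
    using psi_y_s0[OF _ _ _ _ psi_y_den_nonzero]
    by (cases v) (simp_all add: mu_def psi12_simps s1_simps)
qed

lemma acts_by_s2_2:
  "acts_by (s2 2) ((nu E2 E3)
     (Y := (e2 * e3 * \<x> * \<y> - e3 * (e2 * e3 - h1) * \<x> - e3 * h1 * \<y> - h2 * (e2 * e3 - h1)) /
           (e2 * e3 * (\<x> - e3))))"
    (is "acts_by _ ?\<tau>")
proof (rule acts_by_s2[OF acts_by_s1_r(2)])
  note s1_simps = acts_by_var[OF acts_by_s1_r(2)]
    C_automorphism_homs[OF acts_by_C_automorphism[OF acts_by_s1_r(2)]]
    C_automorphism_psi_y[OF acts_by_C_automorphism[OF acts_by_s1_r(2)]]
  \<comment> \<open>The image under \<open>psi12\<close> of the factor \<open>\<x> - e3\<close> in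
    the claimed denominator.\<close>
  have "1 / \<y> - h2 / e3 \<noteq> 0"
    by (rule nonzero_by_sampling, (rule point.has_value_intros | simp)+)
  note psi_y_s2[OF _ _ _ _ _ psi_y_den_nonzero this, where ?u2.0 = e2 and ?u4.0 = e4]
  then show "psi12 (?\<tau> v) = s1 2 (psi12 (var v))" for v
    by (cases v) (simp_all add: nu_def r_def psi12_simps s1_simps ac_simps)
qed

text \<open>All of \<open>s1 4\<close> except a transposition disappears: it fixes
  \<open>psi12 \<x> = 1 / \<y>\<close> and \<open>psi12 \<y>\<close>, and sends
  \<open>psi12 e4 = h2 / e4\<close> to \<open>e5\<close>.\<close>

lemma acts_by_s2_4: "acts_by (s2 4) (r E4 E5)"
proof (rule acts_by_s2[OF acts_by_s1_4])
  note s1_simps = acts_by_var[OF acts_by_s1_4]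
    C_automorphism_homs[OF acts_by_C_automorphism[OF acts_by_s1_4]]
    C_automorphism_psi_y[OF acts_by_C_automorphism[OF acts_by_s1_4]]
  have "h1 * h2 / (e4 * e5) - h2 * s4_x e4 e5 h1 h2 \<x> \<y> * \<y> \<noteq> 0"
    unfolding s4_x_def by (rule nonzero_by_sampling, (rule point.has_value_intros | simp)+)
  note psi_y_s4[OF _ _ _ _ s4_x_den_nonzero psi_y_den_nonzero this, of e3]
  then show "psi12 (r E4 E5 v) = s1 4 (psi12 (var v))" for v
    by (cases v) (simp_all add: r_def psi12_simps s1_simps)
qed

text \<open>Among the \<open>e\<close>s, \<open>psi12\<close> involves only \<open>e3\<close> and
  \<open>e4\<close>, and these symmetrically, so it commutes with each of these
  transpositions.\<close>

lemma acts_by_s2_r: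
  "acts_by (s2 1) (r E1 E2)" "acts_by (s2 3) (r E3 E4)"
  "acts_by (s2 5) (r E5 E6)" "acts_by (s2 6) (r E6 E7)" "acts_by (s2 7) (r E7 E8)"
proof -
  note homs = C_automorphism_homs C_automorphism_psi_y
  note s1_C = acts_by_s1_r[THEN acts_by_C_automorphism]
  have "psi12 (r E1 E2 v) = s1 1 (psi12 (var v))" for v
    \<comment> \<open>Without the deletion \<open>s1 1\<close> would become
      \<open>s1 (Suc 0)\<close> and no longer match the rules for its action.\<close>
    by (cases v)
      (simp_all add: r_def psi12_simps acts_by_s1_r[THEN acts_by_var] homs[OF s1_C(1)]
        del: One_nat_def)
  then show "acts_by (s2 1) (r E1 E2)" by (rule acts_by_s2[OF acts_by_s1_r(1)])
  have "psi12 (r E3 E4 v) = s1 3 (psi12 (var v))" for v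
    by (cases v) (simp_all add: r_def psi12_simps acts_by_s1_r[THEN acts_by_var] homs[OF s1_C(3)]
        psi_y_commute ac_simps)
  then show "acts_by (s2 3) (r E3 E4)" by (rule acts_by_s2[OF acts_by_s1_r(3)])
  have "psi12 (r E5 E6 v) = s1 5 (psi12 (var v))" for v
    by (cases v) (simp_all add: r_def psi12_simps acts_by_s1_r[THEN acts_by_var] homs[OF s1_C(4)])
  then show "acts_by (s2 5) (r E5 E6)" by (rule acts_by_s2[OF acts_by_s1_r(4)])
  have "psi12 (r E6 E7 v) = s1 6 (psi12 (var v))" for v
    by (cases v) (simp_all add: r_def psi12_simps acts_by_s1_r[THEN acts_by_var] homs[OF s1_C(5)])
  then show "acts_by (s2 6) (r E6 E7)" by (rule acts_by_s2[OF acts_by_s1_r(5)])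
  have "psi12 (r E7 E8 v) = s1 7 (psi12 (var v))" for v
    by (cases v) (simp_all add: r_def psi12_simps acts_by_s1_r[THEN acts_by_var] homs[OF s1_C(6)])
  then show "acts_by (s2 7) (r E7 E8)" by (rule acts_by_s2[OF acts_by_s1_r(6)])
qed

lemma acts_by_pi2:
  "acts_by pi2
     (var(H2 := h1 ^ 2 * h2 / (e3 * e4 * e5 * e6),
          E1 := e8, E8 := e1, E2 := e7, E7 := e2,
          E3 := h1 / e6, E4 := h1 / e5, E5 := h1 / e4, E6 := h1 / e3,
          X := h1 / \<x>, Y := pi2_y e3 e4 e5 e6 h1 h2 \<x> \<y>))"
    (is "acts_by _ ?\<tau>")
  unfolding pi2_def
proof (rule acts_by_conjugate[OF _ _ inv_phi12])
  note pi1_simps = acts_by_var[OF acts_by_pi1]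
    C_automorphism_homs[OF acts_by_C_automorphism[OF acts_by_pi1]]
    C_automorphism_psi_y[OF acts_by_C_automorphism[OF acts_by_pi1]]
  \<comment> \<open>The image under \<open>psi12\<close> of
    \<open>\<x> * \<y> - \<x> ^ 2 - h2\<close>; \<open>den'\<close> below is the image under
    \<open>pi1\<close> of the denominator factor of \<open>psi12 \<y>\<close>.\<close>
  have den: "1 / \<y> * psi_y e3 e4 h1 h2 \<x> \<y> - (1 / \<y>) ^ 2 - h1 * h2 / (e3 * e4) \<noteq> 0"
    unfolding psi_y_def
    by (rule nonzero_by_sampling, (rule point.has_value_intros | simp add: power2_eq_square)+)
  have den': "h1 - h2 * (h1 / \<x>) * (1 / (h2 * \<y>)) \<noteq> 0"
    by (rule nonzero_by_sampling, (rule point.has_value_intros | simp)+)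
  note psi_y_pi1[OF _ _ _ _ _ _ _ _ psi_y_den_nonzero den den', of e5 e6]
  then show "psi12 (?\<tau> v) = pi1 (psi12 (var v))" for v
    by (cases v)
      (simp_all add: psi12_simps pi1_simps power2_eq_square
        C_automorphism_pi2_y[OF acts_by_C_automorphism[OF acts_by_psi12]])
qed (use acts_by_phi12 acts_by_psi12 acts_by_pi1 in \<open>simp_all add: acts_by_def\<close>)

section \<open>Elementary symmetric functions as coefficients, and assembly of the result\<close>

lemma quadratic_coefficients:
  fixes p q :: "'a::comm_ring_1"
  assumes "[:1, p:] * [:1, q:] = (\<Sum>i\<le>2. monom (a i) i)"
  shows "a 1 = p + q" and "a 2 = p * q"
proof -
  \<comment> \<open>Beyond the summation range \<open>a\<close> is unconstrained, hence the bound on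
    \<open>k\<close>.\<close>
  have "coeff (\<Sum>i\<le>2. monom (a i) i) k = a k" if "k \<le> 2" for k
    using that by (simp add: coeff_sum)
  then have "a k = coeff ([:1, p:] * [:1, q:]) k" if "k \<le> 2" for k
    using that unfolding assms by simp
  from this[of 1] this[of 2] show "a 1 = p + q" and "a 2 = p * q"
    by (simp_all add: numeral_2_eq_2)
qed

lemma quartic_coefficients:
  fixes p q s t :: "'a::comm_ring_1"
  assumes "[:1, p:] * [:1, q:] * [:1, s:] * [:1, t:] = (\<Sum>i\<le>4. monom (b i) i)"
  shows "b 1 = p + q + s + t"
    and "b 2 = p * q + p * s + p * t + q * s + q * t + s * t"
    and "b 3 = p * q * s + p * q * t + p * s * t + q * s * t"
    and "b 4 = p * q * s * t"
proof -
  have "coeff (\<Sum>i\<le>4. monom (b i) i) k = b k" if "k \<le> 4" for k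
    using that by (simp add: coeff_sum)
  then have "b k = coeff ([:1, p:] * [:1, q:] * [:1, s:] * [:1, t:]) k" if "k \<le> 4" for k
    using that unfolding assms by simp
  from this[of 1] this[of 2] this[of 3] this[of 4]
  show "b 1 = p + q + s + t"
    and "b 2 = p * q + p * s + p * t + q * s + q * t + s * t"
    and "b 3 = p * q * s + p * q * t + p * s * t + q * s * t"
    and "b 4 = p * q * s * t"
    by (simp_all add: numeral_nat algebra_simps)
qed

theorem mainTheorem2:
  fixes a b :: "nat \<Rightarrow> K"
  assumes "[:1, e3:] * [:1, e4:] = (\<Sum>i\<le>2. monom (a i) i)"
    and "[:1, e3:] * [:1, e4:] * [:1, e5:] * [:1, e6:] = (\<Sum>i\<le>4. monom (b i) i)"
  shows
    "acts_by (s2 0) ((mu E3 E4)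
       (X := h2 * (\<x> * \<y> - a 1 * \<x> + a 2 - h2) /
             ((h2 - a 2) * \<x> + a 2 * \<y> - a 1 * h2))) \<and>
     acts_by (s2 1) (r E1 E2) \<and>
     acts_by (s2 2) ((nu E2 E3)
       (Y := (e2 * e3 * \<x> * \<y> - e3 * (e2 * e3 - h1) * \<x> - e3 * h1 * \<y> - h2 * (e2 * e3 - h1)) /
             (e2 * e3 * (\<x> - e3)))) \<and>
     acts_by (s2 3) (r E3 E4) \<and>
     acts_by (s2 4) (r E4 E5) \<and>
     acts_by (s2 5) (r E5 E6) \<and>
     acts_by (s2 6) (r E6 E7) \<and>
     acts_by (s2 7) (r E7 E8) \<and>
     acts_by pi2
       (var(H2 := h1 ^ 2 * h2 / (e3 * e4 * e5 * e6),
            E1 := e8, E8 := e1, E2 := e7, E7 := e2,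
            E3 := h1 / e6, E4 := h1 / e5, E5 := h1 / e4, E6 := h1 / e3,
            X := h1 / \<x>,
            Y := h1 * (h2 * \<x> ^ 2 * \<y> - h2 * b 1 * \<x> ^ 2
                       - (b 4 - h2 * b 2 + h2 ^ 2) * \<x> + b 4 * \<y> - h2 * b 3) /
                 (b 4 * (\<x> * \<y> - \<x> ^ 2 - h2))))"
proof -
  \<comment> \<open>The two fractions differ by a sign in both numerator and denominator.\<close>
  have s2_0: "h2 * (\<x> * \<y> - a 1 * \<x> + a 2 - h2) / ((h2 - a 2) * \<x> + a 2 * \<y> - a 1 * h2) =
      phi12_x e3 e4 h2 \<x> \<y>"
  proof -
    have "h2 * (\<x> * \<y> - a 1 * \<x> + a 2 - h2) = - (h2 * (a 1 * \<x> - a 2 + h2 - \<x> * \<y>))"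
      and "(h2 - a 2) * \<x> + a 2 * \<y> - a 1 * h2 = - (a 1 * h2 + (a 2 - h2) * \<x> - a 2 * \<y>)"
      by (simp_all add: algebra_simps)
    then show ?thesis
      unfolding phi12_x_def quadratic_coefficients[OF assms(1)] by (simp only: minus_divide_divide)
  qed
  show ?thesis
    unfolding s2_0 quartic_coefficients[OF assms(2)]
    using acts_by_s2_0 acts_by_s2_2 acts_by_s2_4 acts_by_s2_r acts_by_pi2[unfolded pi2_y_def Let_def]
    by (intro conjI)
qed

end
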